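(* Suppose $\theta_1,\theta_2\in\mathbb{R}_{>0}$ with $\theta_1\theta_2\ge1$. There exists a nontrivial continuous horizontal unilateral wave solution $u:\mathbb{R}^2\to\mathbb{C}$ to the Klein-Gordon equation $u''_{xy}+u=0$ such that the restriction of $u$ to the quarter-plane $\mathbb{R}_{\ge0}\times\mathbb{R}_{\le0}$ does not vanish identically, while it meets the uniform growth condition $$|u(x,y)|=\mathrm{O}\big(\exp(\theta_1 x+\theta_2|y|)\big),\qquad (x,y)\in\mathbb{R}_{\ge0}\times\mathbb{R}_{\le0}.$$
   Context: Here $u''_{xy}=\partial_x\partial_y u$, and the Klein-Gordon equation is understood in the sense of distribution theory. For $a=0,1,2,\ldots$ put $$J_{0,a}(y,x):=J_{a,0}(x,y):=\sum_{j=0}^{+\infty}\frac{(-1)^j}{(j+a)!\,j!}\,x^{j+a}y^j .$$ For continuous $f,g:\mathbb{R}\to\mathbb{C}$ with $f(0)=g(0)$, Riemann's solution is $$\mathbf{R}[f,g](x,y):=f(x)+g(y)-f(0)J_{0,0}(x,y)-\int_0^x J_{0,1}(x-s,y)f(s)\,\mathrm{d}s-\int_0^y J_{1,0}(x,y-t)g(t)\,\mathrm{d}t .$$ A horizontal unilateral wave solution is a function of the form $\mathbf{R}[f_0,0]$, where $f_0:\mathbb{R}\to\mathbb{C}$ is continuous with $f_0(0)=0$. The uniform growth condition means that there is a constant $C$, independent of $(x,y)$, such that $|u(x,y)|\le C\exp(\theta_1 x+\theta_2|y|)$ on the indicated set. *)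

theory Defs
  imports "HOL-Analysis.Analysis"
begin

subsection \<open>Distributions on the plane\<close>

definition partial_x :: "(real \<times> real \<Rightarrow> complex) \<Rightarrow> real \<times> real \<Rightarrow> complex" where
  "partial_x \<phi> = (\<lambda>(x, y). vector_derivative (\<lambda>s. \<phi> (s, y)) (at x))"

definition partial_y :: "(real \<times> real \<Rightarrow> complex) \<Rightarrow> real \<times> real \<Rightarrow> complex" where
  "partial_y \<phi> = (\<lambda>(x, y). vector_derivative (\<lambda>t. \<phi> (x, t)) (at y))"

text \<open>Class \<open>C\<^sup>k\<close>. Differentiability is required at each stage because
  \<^const>\<open>vector_derivative\<close> is an arbitrary value where no derivative exists.\<close>

primrec Ck :: "nat \<Rightarrow> (real \<times> real \<Rightarrow> complex) \<Rightarrow> bool" where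
  "Ck 0 \<phi> \<longleftrightarrow> continuous_on UNIV \<phi>"
| "Ck (Suc k) \<phi> \<longleftrightarrow> \<phi> differentiable_on UNIV \<and> Ck k (partial_x \<phi>) \<and> Ck k (partial_y \<phi>)"

definition test_functions :: "(real \<times> real \<Rightarrow> complex) set" where
  "test_functions = {\<phi>. (\<forall>k. Ck k \<phi>) \<and> compact (closure {p. \<phi> p \<noteq> 0})}"

text \<open>Distributions are represented by functionals that are only ever evaluated on
  \<^const>\<open>test_functions\<close>. The functional of \<open>u\<close> is meaningful for locally integrable
  (in particular, continuous) \<open>u\<close>.\<close>

definition regular_distribution ::
  "(real \<times> real \<Rightarrow> complex) \<Rightarrow> (real \<times> real \<Rightarrow> complex) \<Rightarrow> complex" where
  "regular_distribution u \<phi> = (LINT p|lborel. u p * \<phi> p)"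

definition dist_dx ::
  "((real \<times> real \<Rightarrow> complex) \<Rightarrow> complex) \<Rightarrow> (real \<times> real \<Rightarrow> complex) \<Rightarrow> complex" where
  "dist_dx T \<phi> = - T (partial_x \<phi>)"

definition dist_dy ::
  "((real \<times> real \<Rightarrow> complex) \<Rightarrow> complex) \<Rightarrow> (real \<times> real \<Rightarrow> complex) \<Rightarrow> complex" where
  "dist_dy T \<phi> = - T (partial_y \<phi>)"

definition klein_gordon_solution :: "(real \<times> real \<Rightarrow> complex) \<Rightarrow> bool" where
  "klein_gordon_solution u \<longleftrightarrow>
     (\<forall>\<phi>\<in>test_functions.
        dist_dx (dist_dy (regular_distribution u)) \<phi> + regular_distribution u \<phi> = 0)"

subsection \<open>Riemann's solution and unilateral waves\<close>

text \<open>\<open>bessel_J_left a\<close> is $J_{a,0}$ and \<open>bessel_J_right a\<close> is $J_{0,a}$.\<close>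

definition bessel_J_left :: "nat \<Rightarrow> real \<Rightarrow> real \<Rightarrow> real" where
  "bessel_J_left a x y = (\<Sum>j. (- 1) ^ j / (fact (j + a) * fact j) * x ^ (j + a) * y ^ j)"

definition bessel_J_right :: "nat \<Rightarrow> real \<Rightarrow> real \<Rightarrow> real" where
  "bessel_J_right a y x = bessel_J_left a x y"

text \<open>The interval integrals are oriented, so negative \<open>x\<close> and \<open>y\<close> are covered.\<close>

definition riemann_solution ::
  "(real \<Rightarrow> complex) \<Rightarrow> (real \<Rightarrow> complex) \<Rightarrow> real \<times> real \<Rightarrow> complex" where
  "riemann_solution f g = (\<lambda>(x, y).
     f x + g y - f 0 * complex_of_real (bessel_J_left 0 x y)
       - (CLBINT s=0..x. complex_of_real (bessel_J_right 1 (x - s) y) * f s)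
       - (CLBINT t=0..y. complex_of_real (bessel_J_left 1 x (y - t)) * g t))"

definition horizontal_unilateral_wave :: "(real \<times> real \<Rightarrow> complex) \<Rightarrow> bool" where
  "horizontal_unilateral_wave u \<longleftrightarrow>
     (\<exists>f. continuous_on UNIV f \<and> f 0 = 0 \<and> u = riemann_solution f (\<lambda>_. 0))"

end

theory Submission
  imports Defs
begin

text \<open>The wave is \<open>J\<^sub>1\<^sub>,\<^sub>0\<close>, which is Riemann's solution for the datum \<open>f(x) = x\<close>. On the
  quarter-plane all terms of its series are nonnegative; rescaled by \<open>X = \<theta>\<^sub>1 x\<close> and
  \<open>Y = \<bar>y\<bar> / \<theta>\<^sub>1 \<le> \<theta>\<^sub>2 \<bar>y\<bar>\<close> they are diagonal terms of the double series of \<open>exp X * exp Y\<close>.\<close>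

subsection \<open>The entire functions behind the Bessel kernels\<close>

definition bessel_coeff :: "nat \<Rightarrow> nat \<Rightarrow> real" where
  "bessel_coeff a j = (- 1) ^ j / (fact (j + a) * fact j)"

text \<open>For \<open>z > 0\<close> this is \<open>z^(-a/2) J_a(2 sqrt z)\<close> with
  \<open>J_a\<close> the classical Bessel function. It reduces the two-variable kernels to power
  series in \<open>z = x y\<close>.\<close>

definition bessel_entire :: "nat \<Rightarrow> real \<Rightarrow> real" where
  "bessel_entire a z = (\<Sum>j. bessel_coeff a j * z ^ j)"

lemma summable_bessel: "summable (\<lambda>j. bessel_coeff a j * z ^ j)"
proof (rule summable_comparison_test)
  have "norm (bessel_coeff a j * z ^ j) \<le> \<bar>z\<bar> ^ j /\<^sub>R fact j" for j
  proof -
    have "norm (bessel_coeff a j * z ^ j) = \<bar>z\<bar> ^ j / fact j / fact (j + a)"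
      by (simp add: bessel_coeff_def abs_mult power_abs)
    also have "\<dots> \<le> \<bar>z\<bar> ^ j / fact j / 1"
      by (intro divide_left_mono) (simp_all add: fact_ge_1)
    finally show ?thesis by (simp add: divide_inverse mult.commute)
  qed
  then show "\<exists>N. \<forall>n\<ge>N. norm (bessel_coeff a n * z ^ n) \<le> \<bar>z\<bar> ^ n /\<^sub>R fact n" by blast
  show "summable (\<lambda>n. \<bar>z\<bar> ^ n /\<^sub>R fact n)" by (rule summable_exp_generic)
qed

lemma bessel_entire_sums: "(\<lambda>j. bessel_coeff a j * z ^ j) sums bessel_entire a z"
  unfolding bessel_entire_def by (rule summable_sums[OF summable_bessel])

lemma diffs_bessel_coeff: "diffs (bessel_coeff a) j = - bessel_coeff (Suc a) j"
  by (simp add: diffs_def bessel_coeff_def divide_simps del: of_nat_Suc)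

lemma DERIV_bessel_entire:
  "(bessel_entire a has_real_derivative - bessel_entire (Suc a) z) (at z)"
proof -
  have "(\<Sum>j. diffs (bessel_coeff a) j * z ^ j) = - bessel_entire (Suc a) z"
    using sums_minus[OF bessel_entire_sums[of "Suc a" z]]
    by (simp add: diffs_bessel_coeff sums_iff)
  with termdiffs_strong_converges_everywhere[OF summable_bessel, of a z] show ?thesis
    by (simp add: bessel_entire_def[abs_def])
qed

text \<open>The three-term recurrence of Bessel functions, by comparing coefficients. It serves to
  differentiate the kernels in \<open>x\<close>.\<close>

lemma bessel_entire_rec:
  "bessel_entire a z = (real a + 1) * bessel_entire (Suc a) z - z * bessel_entire (Suc (Suc a)) z"
proof -
  \<comment> \<open>The series of \<open>z * bessel_entire (Suc (Suc a)) z\<close> with a zero term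
    put in front, so that the term at \<open>j\<close> carries \<open>z ^ j\<close>.\<close>
  define h where "h j = (case j of 0 \<Rightarrow> 0 | Suc i \<Rightarrow> z * (bessel_coeff (Suc (Suc a)) i * z ^ i))" for j
  have "(\<lambda>j. h (Suc j)) sums (z * bessel_entire (Suc (Suc a)) z)"
    using sums_mult[OF bessel_entire_sums] by (simp add: h_def)
  then have "h sums (z * bessel_entire (Suc (Suc a)) z)"
    using sums_Suc[of h] by (simp add: h_def)
  then have "(\<lambda>j. (real a + 1) * (bessel_coeff (Suc a) j * z ^ j) - h j) sums
      ((real a + 1) * bessel_entire (Suc a) z - z * bessel_entire (Suc (Suc a)) z)"
    by (intro sums_diff sums_mult bessel_entire_sums)
  moreover have "(real a + 1) * (bessel_coeff (Suc a) j * z ^ j) - h j = bessel_coeff a j * z ^ j" for j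
  proof (cases j)
    case (Suc i)
    have "(real a + 1) * bessel_coeff (Suc a) (Suc i) - bessel_coeff (Suc (Suc a)) i
        = bessel_coeff a (Suc i)"
      by (simp add: bessel_coeff_def divide_simps) (simp add: algebra_simps)
    then have "((real a + 1) * bessel_coeff (Suc a) j - bessel_coeff (Suc (Suc a)) i) * z ^ j
        = bessel_coeff a j * z ^ j"
      by (simp only: Suc)
    moreover have "h j = bessel_coeff (Suc (Suc a)) i * z ^ j"
      by (simp add: Suc h_def)
    ultimately show ?thesis
      by (simp only: left_diff_distrib mult.assoc)
  qed (simp add: h_def bessel_coeff_def del: of_nat_Suc, simp add: divide_simps add.commute)
  ultimately show ?thesis
    using bessel_entire_sums[of a z] by (simp add: sums_iff)
qed

subsection \<open>The Bessel kernels\<close>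

lemma bessel_J_left_eq: "bessel_J_left a x y = x ^ a * bessel_entire a (x * y)"
proof -
  have "x ^ a * bessel_entire a (x * y) = (\<Sum>j. x ^ a * (bessel_coeff a j * (x * y) ^ j))"
    unfolding bessel_entire_def by (rule suminf_mult[OF summable_bessel, symmetric])
  then show ?thesis
    by (simp add: bessel_J_left_def bessel_coeff_def power_add power_mult_distrib mult_ac)
qed

lemmas DERIV_bessel_entire_chain [derivative_intros] = DERIV_bessel_entire[THEN DERIV_chain2]

lemma DERIV_bessel_J_left_snd:
  "((\<lambda>t. bessel_J_left a x t) has_real_derivative - bessel_J_left (Suc a) x y) (at y)"
  unfolding bessel_J_left_eq
  by (auto intro!: derivative_eq_intros)

text \<open>The recurrence merges the two terms of the product rule. Together with the derivative in
  \<open>y\<close>, this makes every \<open>bessel_J_left (Suc a)\<close> a classical solution of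
  the Klein-Gordon equation.\<close>

lemma DERIV_bessel_J_left_fst:
  "((\<lambda>s. bessel_J_left (Suc a) s y) has_real_derivative bessel_J_left a x y) (at x)"
  unfolding bessel_J_left_eq
  by (rule derivative_eq_intros refl)+ (simp add: bessel_entire_rec[of a] algebra_simps)

lemmas DERIV_bessel_J_left_chain [derivative_intros] =
  DERIV_bessel_J_left_fst[THEN DERIV_chain2] DERIV_bessel_J_left_snd[THEN DERIV_chain2]

lemma bessel_J_left_0_commute: "bessel_J_left 0 x y = bessel_J_left 0 y x"
  by (simp add: bessel_J_left_eq mult.commute)

lemma bessel_J_left_Suc_zero: "bessel_J_left (Suc a) 0 y = 0"
  by (simp add: bessel_J_left_eq)

lemma bessel_J_left_zero: "bessel_J_left a x 0 = x ^ a / fact a"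
  using powser_zero[of "bessel_coeff a"]
  by (simp add: bessel_J_left_eq bessel_entire_def bessel_coeff_def)

lemma continuous_on_bessel_J_left [continuous_intros]:
  assumes "continuous_on S f" "continuous_on S g"
  shows "continuous_on S (\<lambda>p. bessel_J_left a (f p) (g p))"
proof -
  have "continuous_on UNIV (bessel_entire a)"
    by (intro continuous_at_imp_continuous_on ballI DERIV_isCont[OF DERIV_bessel_entire])
  from continuous_on_compose2[OF this continuous_on_mult[OF assms]]
  have "continuous_on S (\<lambda>p. bessel_entire a (f p * g p))" by simp
  then show ?thesis
    unfolding bessel_J_left_eq by (intro continuous_on_mult continuous_on_power assms(1))
qed

section \<open>Exponential growth of the kernels\<close>

lemma power_div_fact_le_exp:
  fixes x :: real
  assumes "x \<ge> 0"
  shows "x ^ n / fact n \<le> exp x"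
proof -
  have "(\<Sum>i\<in>{n}. x ^ i /\<^sub>R fact i) \<le> (\<Sum>i. x ^ i /\<^sub>R fact i)"
    using assms by (intro sum_le_suminf summable_exp_generic) auto
  then show ?thesis by (simp add: exp_def divide_inverse mult.commute)
qed

text \<open>In each term \<open>(\<theta> * x) ^ (j + a) / fact (j + a)\<close> is at most
  \<open>exp (\<theta> * x)\<close> for all \<open>j\<close>, and the remaining factors sum to
  \<open>exp (\<bar>y\<bar> / \<theta>)\<close>. Rescaling \<open>x\<close> leaves
  \<open>1 / \<theta> ^ a\<close>.\<close>

lemma abs_bessel_J_left_le:
  assumes "\<theta> > 0" "x \<ge> 0"
  shows "\<bar>bessel_J_left a x y\<bar> \<le> exp (\<theta> * x + \<bar>y\<bar> / \<theta>) / \<theta> ^ a"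
proof -
  let ?g = "\<lambda>j. exp (\<theta> * x) / \<theta> ^ a * ((\<bar>y\<bar> / \<theta>) ^ j /\<^sub>R fact j)"
  have g: "?g sums (exp (\<theta> * x) / \<theta> ^ a * exp (\<bar>y\<bar> / \<theta>))"
    by (intro sums_mult exp_converges)
  have "norm ((- 1) ^ j / (fact (j + a) * fact j) * x ^ (j + a) * y ^ j) \<le> ?g j" for j
  proof -
    have "norm ((- 1) ^ j / (fact (j + a) * fact j) * x ^ (j + a) * y ^ j) =
        ((\<theta> * x) ^ (j + a) / fact (j + a)) / \<theta> ^ a * ((\<bar>y\<bar> / \<theta>) ^ j /\<^sub>R fact j)"
      using assms by (simp add: abs_mult power_abs power_mult_distrib power_add field_simps)
    also have "\<dots> \<le> ?g j"
      using assms by (intro mult_right_mono divide_right_mono power_div_fact_le_exp) auto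
    finally show ?thesis .
  qed
  then have "norm (bessel_J_left a x y) \<le> suminf ?g"
    unfolding bessel_J_left_def using g by (intro norm_suminf_le) (auto simp: sums_iff)
  with g show ?thesis by (simp add: sums_iff exp_add)
qed

text \<open>With \<open>A r = 1 - J\<^sub>0\<^sub>,\<^sub>0(y, r)\<close> and \<open>B r = r - J\<^sub>1\<^sub>,\<^sub>0(r, y)\<close> one has \<open>A' = J\<^sub>1\<^sub>,\<^sub>0(y, \<cdot>)\<close> and
  \<open>B' = A\<close>, so \<open>- s A (x - s) - B (x - s)\<close> is a primitive of the integrand.\<close>

lemma riemann_solution_linear:
  "riemann_solution complex_of_real (\<lambda>_. 0) = (\<lambda>(x, y). complex_of_real (bessel_J_left 1 x y))"
proof -
  have "(CLBINT s=0..x. complex_of_real (bessel_J_right 1 (x - s) y) * complex_of_real s)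
      = complex_of_real (x - bessel_J_left 1 x y)" for x y
  proof -
    define P where
      "P s = - s * (1 - bessel_J_left 0 y (x - s)) - (x - s - bessel_J_left 1 (x - s) y)" for s
    have D: "(P has_real_derivative bessel_J_left 1 y (x - s) * s) (at s)" for s
      unfolding P_def One_nat_def
      \<comment> \<open>All terms but the integrand cancel, by the symmetry of
        \<open>bessel_J_left 0\<close>.\<close>
      by (rule derivative_eq_intros refl)+
        (simp add: bessel_J_left_0_commute[of y] algebra_simps)
    have "(CLBINT s=ereal 0..ereal x.
        complex_of_real (bessel_J_right 1 (x - s) y) * complex_of_real s)
      = complex_of_real (P x) - complex_of_real (P 0)"
    proof (rule interval_integral_FTC_finite)
      show "continuous_on {min 0 x..max 0 x}
          (\<lambda>s. complex_of_real (bessel_J_right 1 (x - s) y) * complex_of_real s)"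
        unfolding bessel_J_right_def by (intro continuous_intros)
      show "((\<lambda>s. complex_of_real (P s)) has_vector_derivative
          complex_of_real (bessel_J_right 1 (x - s) y) * complex_of_real s)
          (at s within {min 0 x..max 0 x})" for s
        using has_vector_derivative_of_real[OF D[of s], THEN has_vector_derivative_at_within]
        by (simp add: bessel_J_right_def)
    qed
    \<comment> \<open>\<open>P x = 0\<close> because \<open>bessel_J_left 0 y 0 = 1\<close> and
      \<open>bessel_J_left 1 0 y = 0\<close>; the value comes from \<open>- P 0\<close>.\<close>
    then show ?thesis
      by (simp add: P_def bessel_J_left_zero bessel_J_left_Suc_zero flip: zero_ereal_def)
  qed
  then show ?thesis
    by (auto simp: riemann_solution_def fun_eq_iff)
qed

subsection \<open>Integration by parts against test functions\<close>

text \<open>The complement of \<open>K\<close> is open, so the slice is zero near \<open>y\<close>.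
  Thus partial derivatives inherit the support.\<close>

lemma vanishing_slice_derivative:
  fixes F :: "'a::topological_space \<times> real \<Rightarrow> 'b::real_normed_vector"
  assumes "closed K" and "\<And>p. p \<notin> K \<Longrightarrow> F p = 0" and "(x, y) \<notin> K"
    and "((\<lambda>t. F (x, t)) has_vector_derivative D) (at y)"
  shows "D = 0"
proof -
  have "open {t. (x, t) \<notin> K}"
    using open_vimage[of "- K" "\<lambda>t. (x, t)"] assms(1)
    by (simp add: continuous_on_Pair vimage_def open_Compl)
  then have "((\<lambda>t. 0) has_vector_derivative D) (at y)"
    using assms by (intro has_vector_derivative_transform_within_open[OF assms(4)]) auto
  then show ?thesis
    using vector_derivative_unique_at has_vector_derivative_const by blast
qed

lemma compactly_supported_integrable:
  fixes f :: "'a::euclidean_space \<Rightarrow> 'b::euclidean_space"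
  assumes "compact K" "\<And>p. p \<notin> K \<Longrightarrow> f p = 0" "continuous_on UNIV f"
  shows "integrable lborel f"
proof -
  have "(\<lambda>p. indicator K p *\<^sub>R f p) = f"
    using assms(2) by (auto simp: indicator_def fun_eq_iff)
  then show ?thesis
    using borel_integrable_compact[OF assms(1) continuous_on_subset[OF assms(3)]] by simp
qed

text \<open>Fubini reduces this to slices, where the fundamental theorem of calculus leaves boundary
  values outside the support.\<close>

lemma integral_partial_snd_eq_0:
  fixes F F' :: "real \<times> real \<Rightarrow> 'b::euclidean_space"
  assumes K: "compact K" "\<And>p. p \<notin> K \<Longrightarrow> F p = 0"
    and D: "\<And>x y. ((\<lambda>t. F (x, t)) has_vector_derivative F' (x, y)) (at y)"
    and C: "continuous_on UNIV F'"
  shows "integrable lborel F'" and "(LINT p|lborel. F' p) = 0"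
proof -
  have F'0: "F' p = 0" if "p \<notin> K" for p
    using vanishing_slice_derivative[OF compact_imp_closed[OF K(1)] K(2) _ D, of "fst p" "snd p"] that
    by simp
  show int: "integrable lborel F'"
    using compactly_supported_integrable[OF K(1) F'0 C] .
  \<comment> \<open>The strict bound puts the endpoints \<open>M\<close> and \<open>- M\<close>
    themselves outside \<open>K\<close>.\<close>
  obtain M where M: "M > 0" "\<And>p. p \<in> K \<Longrightarrow> norm p < M"
    using compact_imp_bounded[OF K(1)] unfolding bounded_pos_less by blast
  have out: "(x, y) \<notin> K" if "\<bar>y\<bar> \<ge> M" for x y
    using M(2)[of "(x, y)"] norm_snd_le[of y x] that by fastforce
  have "(LINT y|lborel. F' (x, y)) = 0" for x
  proof -
    have "(LINT y|lborel. F' (x, y)) = (LINT y|lborel. indicator {- M..M} y *\<^sub>R F' (x, y))"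
      using F'0 out[of _ x] by (intro Bochner_Integration.integral_cong) (auto simp: indicator_def)
    also have "\<dots> = F (x, M) - F (x, - M)"
    proof (rule integral_FTC_Icc)
      show "continuous_on {- M..M} (\<lambda>y. F' (x, y))"
        by (rule continuous_on_compose2[OF C]) (auto intro!: continuous_intros)
    qed (use M(1) D in \<open>auto intro: has_vector_derivative_at_within\<close>)
    also have "\<dots> = 0"
      using K(2) out[of M x] out[of "- M" x] M(1) by simp
    finally show ?thesis .
  qed
  moreover have "(LINT x|lborel. LINT y|lborel. F' (x, y)) = (LINT p|lborel. F' p)"
    using lborel_pair.integral_fst'[of F'] int by (simp add: lborel_prod)
  ultimately show "(LINT p|lborel. F' p) = 0" by simp
qed

text \<open>Swapping coordinates preserves Lebesgue measure and reduces this to the other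
  variable.\<close>

lemma integral_partial_fst_eq_0:
  fixes F F' :: "real \<times> real \<Rightarrow> 'b::euclidean_space"
  assumes K: "compact K" "\<And>p. p \<notin> K \<Longrightarrow> F p = 0"
    and D: "\<And>x y. ((\<lambda>s. F (s, y)) has_vector_derivative F' (x, y)) (at x)"
    and C: "continuous_on UNIV F'"
  shows "integrable lborel F'" and "(LINT p|lborel. F' p) = 0"
proof -
  have sw: "integrable lborel (F' \<circ> prod.swap)" "(LINT p|lborel. (F' \<circ> prod.swap) p) = 0"
  proof -
    have "compact (prod.swap ` K)"
      by (intro compact_continuous_image K continuous_intros)
    moreover have "(F \<circ> prod.swap) p = 0" if "p \<notin> prod.swap ` K" for p
      using K(2)[of "prod.swap p"] that by (metis comp_apply image_eqI swap_swap)
    moreover have "continuous_on UNIV (F' \<circ> prod.swap)"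
      by (rule continuous_on_compose[OF _ continuous_on_subset[OF C]]) (auto intro: continuous_on_swap)
    ultimately show "integrable lborel (F' \<circ> prod.swap)" "(LINT p|lborel. (F' \<circ> prod.swap) p) = 0"
      using integral_partial_snd_eq_0[of "prod.swap ` K" "F \<circ> prod.swap" "F' \<circ> prod.swap"] D
      by auto
  qed
  show int: "integrable lborel F'"
    using sw(1) lborel_pair.integrable_product_swap[of "F' \<circ> prod.swap"]
    by (simp add: lborel_prod case_prod_unfold)
  show "(LINT p|lborel. F' p) = 0"
    using sw(2) lborel_pair.integral_product_swap[of F'] int
    by (simp add: lborel_prod case_prod_unfold prod.swap_def comp_def)
qed

lemma partial_x_has_vector_derivative:
  assumes "\<phi> differentiable_on UNIV"
  shows "((\<lambda>s. \<phi> (s, y)) has_vector_derivative partial_x \<phi> (x, y)) (at x)"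
proof -
  have "\<phi> differentiable (at (x, y))"
    using assms by (simp add: differentiable_on_def)
  then have "(\<lambda>s. \<phi> (s, y)) differentiable (at x)"
    by (intro differentiable_compose[of \<phi> "\<lambda>s. (s, y)"]) (auto simp: differentiable_def intro!: exI derivative_intros)
  then show ?thesis
    by (simp add: partial_x_def vector_derivative_works)
qed

lemma partial_y_has_vector_derivative:
  assumes "\<phi> differentiable_on UNIV"
  shows "((\<lambda>t. \<phi> (x, t)) has_vector_derivative partial_y \<phi> (x, y)) (at y)"
proof -
  have "\<phi> differentiable (at (x, y))"
    using assms by (simp add: differentiable_on_def)
  then have "(\<lambda>t. \<phi> (x, t)) differentiable (at y)"
    by (intro differentiable_compose[of \<phi> "\<lambda>t. (x, t)"]) (auto simp: differentiable_def intro!: exI derivative_intros)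
  then show ?thesis
    by (simp add: partial_y_def vector_derivative_works)
qed

text \<open>A classical solution is a distributional one because
  \<open>u \<phi>\<^sub>x\<^sub>y + u \<phi> = (u \<phi>\<^sub>x)\<^sub>y - (u\<^sub>y \<phi>)\<^sub>x\<close>.\<close>

lemma classical_imp_klein_gordon_solution:
  assumes u: "continuous_on UNIV u" "continuous_on UNIV v"
    and uy: "\<And>x y. ((\<lambda>t. u (x, t)) has_vector_derivative v (x, y)) (at y)"
    and vx: "\<And>x y. ((\<lambda>s. v (s, y)) has_vector_derivative - u (x, y)) (at x)"
  shows "klein_gordon_solution u"
  unfolding klein_gordon_solution_def
proof
  fix \<phi> assume "\<phi> \<in> test_functions"
  then have smooth: "Ck k \<phi>" for k
    by (simp add: test_functions_def)
  obtain K where K: "compact K" and \<phi>0: "\<And>p. p \<notin> K \<Longrightarrow> \<phi> p = 0"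
  proof
    show "compact (closure {p. \<phi> p \<noteq> 0})"
      using \<open>\<phi> \<in> test_functions\<close> by (simp add: test_functions_def)
    show "\<phi> p = 0" if "p \<notin> closure {p. \<phi> p \<noteq> 0}" for p
      using that closure_subset[of "{p. \<phi> p \<noteq> 0}"] by blast
  qed
  have d: "\<phi> differentiable_on UNIV" and dx: "partial_x \<phi> differentiable_on UNIV"
    and cx: "continuous_on UNIV (partial_x \<phi>)"
    and cxy: "continuous_on UNIV (partial_y (partial_x \<phi>))"
    using smooth[of "Suc (Suc 0)"] smooth[of "Suc 0"] by simp_all
  have c: "continuous_on UNIV \<phi>"
    using smooth[of 0] by simp
  \<comment> \<open>The support lemma treats the second coordinate, hence the swap.\<close>
  have \<phi>x0: "partial_x \<phi> p = 0" if "p \<notin> K" for p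
  proof -
    have "(snd p, fst p) \<notin> prod.swap ` K"
      using that by (metis prod.swap_def swap_swap imageE)
    moreover have "closed (prod.swap ` K)"
      by (intro compact_imp_closed compact_continuous_image K continuous_intros)
    moreover have "(\<phi> \<circ> prod.swap) q = 0" if "q \<notin> prod.swap ` K" for q
      using that \<phi>0[of "prod.swap q"] by (metis comp_apply image_eqI swap_swap)
    ultimately show ?thesis
      using vanishing_slice_derivative[of "prod.swap ` K" "\<phi> \<circ> prod.swap" "snd p" "fst p" "partial_x \<phi> p"]
        partial_x_has_vector_derivative[OF d, of "snd p" "fst p"] by simp
  qed
  define Fy where "Fy p = u p * partial_y (partial_x \<phi>) p + v p * partial_x \<phi> p" for p
  define Gx where "Gx p = v p * partial_x \<phi> p - u p * \<phi> p" for p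
  have 1: "((\<lambda>t. u (x, t) * partial_x \<phi> (x, t)) has_vector_derivative Fy (x, y)) (at y)" for x y
    unfolding Fy_def
    by (rule has_vector_derivative_mult[OF uy partial_y_has_vector_derivative[OF dx]])
  have 2: "((\<lambda>s. v (s, y) * \<phi> (s, y)) has_vector_derivative Gx (x, y)) (at x)" for x y
    using has_vector_derivative_mult[OF vx partial_x_has_vector_derivative[OF d]]
    by (simp add: Gx_def)
  have cF: "continuous_on UNIV Fy" and cG: "continuous_on UNIV Gx"
    unfolding Fy_def Gx_def by (intro continuous_intros u c cx cxy)+
  have F: "integrable lborel Fy" "(LINT p|lborel. Fy p) = 0"
    by (rule integral_partial_snd_eq_0[where F = "\<lambda>p. u p * partial_x \<phi> p", OF K _ 1 cF];
        simp add: \<phi>x0)+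
  have G: "integrable lborel Gx" "(LINT p|lborel. Gx p) = 0"
    by (rule integral_partial_fst_eq_0[where F = "\<lambda>p. v p * \<phi> p", OF K _ 2 cG];
        simp add: \<phi>0)+
  have i\<phi>: "integrable lborel (\<lambda>p. u p * \<phi> p)"
    by (rule compactly_supported_integrable[OF K]) (auto simp: \<phi>0 intro!: continuous_intros u c)
  have eq: "u p * partial_y (partial_x \<phi>) p = Fy p - Gx p - u p * \<phi> p" for p
    by (simp add: Fy_def Gx_def)
  have "(LINT p|lborel. u p * partial_y (partial_x \<phi>) p) = - (LINT p|lborel. u p * \<phi> p)"
    unfolding eq using F G i\<phi> by simp
  \<comment> \<open>The two minus signs cancel, and \<open>\<phi>\<close> is differentiated first in
    \<open>x\<close>, then in \<open>y\<close>.\<close>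
  then show "dist_dx (dist_dy (regular_distribution u)) \<phi> + regular_distribution u \<phi> = 0"
    by (simp add: dist_dx_def dist_dy_def regular_distribution_def)
qed

theorem theorem1p16:
  fixes \<theta>1 \<theta>2 :: real
  assumes "\<theta>1 > 0" and "\<theta>2 > 0" and "\<theta>1 * \<theta>2 \<ge> 1"
  shows "\<exists>u :: real \<times> real \<Rightarrow> complex.
           continuous_on UNIV u \<and>
           horizontal_unilateral_wave u \<and>
           klein_gordon_solution u \<and>
           (\<exists>p. u p \<noteq> 0) \<and>
           (\<exists>x y. x \<ge> 0 \<and> y \<le> 0 \<and> u (x, y) \<noteq> 0) \<and>
           (\<exists>C. \<forall>x y. x \<ge> 0 \<longrightarrow> y \<le> 0 \<longrightarrow>
                  norm (u (x, y)) \<le> C * exp (\<theta>1 * x + \<theta>2 * \<bar>y\<bar>))"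
proof -
  define u where "u = (\<lambda>(x, y). complex_of_real (bessel_J_left 1 x y))"
  have cont: "continuous_on UNIV (\<lambda>(x, y). complex_of_real (bessel_J_left a x y))" for a
    by (auto simp: case_prod_unfold intro!: continuous_intros)
  have "horizontal_unilateral_wave u"
    unfolding horizontal_unilateral_wave_def u_def
    by (rule exI[of _ complex_of_real]) (auto simp: riemann_solution_linear intro!: continuous_intros)
  moreover have "klein_gordon_solution u"
  proof (rule classical_imp_klein_gordon_solution)
    \<comment> \<open>The \<open>y\<close>-derivative of \<open>u\<close>; differentiating it in
      \<open>x\<close> returns \<open>- u\<close>.\<close>
    let ?v = "\<lambda>p. - (\<lambda>(x, y). complex_of_real (bessel_J_left 2 x y)) p"
    show "continuous_on UNIV u" "continuous_on UNIV ?v"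
      unfolding u_def by (intro continuous_intros cont)+
    show "((\<lambda>t. u (x, t)) has_vector_derivative ?v (x, y)) (at y)" for x y
      using has_vector_derivative_of_real[OF DERIV_bessel_J_left_snd[of 1 x y]]
      by (simp add: u_def numeral_2_eq_2)
    show "((\<lambda>s. ?v (s, y)) has_vector_derivative - u (x, y)) (at x)" for x y
      using has_vector_derivative_minus[OF has_vector_derivative_of_real[OF DERIV_bessel_J_left_fst[of 1 y x]]]
      by (simp add: u_def numeral_2_eq_2)
  qed
  \<comment> \<open>Since \<open>u (x, 0) = x\<close>, this point of the closed quarter-plane
    settles both nonvanishing claims.\<close>
  moreover have "u (1, 0) \<noteq> 0"
    by (simp add: u_def bessel_J_left_zero)
  moreover have "norm (u (x, y)) \<le> 1 / \<theta>1 * exp (\<theta>1 * x + \<theta>2 * \<bar>y\<bar>)" if "x \<ge> 0" for x y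
  proof -
    \<comment> \<open>Here \<open>\<theta>1 * \<theta>2 \<ge> 1\<close> enters: it lets
      \<open>\<theta>2\<close> absorb the rate \<open>1 / \<theta>1\<close> in
      \<open>\<bar>y\<bar>\<close>.\<close>
    have "1 / \<theta>1 \<le> \<theta>2"
      using assms by (simp add: field_simps)
    then have "\<bar>y\<bar> / \<theta>1 \<le> \<theta>2 * \<bar>y\<bar>"
      using mult_right_mono[of "1 / \<theta>1" \<theta>2 "\<bar>y\<bar>"] by simp
    then have "exp (\<theta>1 * x + \<bar>y\<bar> / \<theta>1) / \<theta>1 \<le> exp (\<theta>1 * x + \<theta>2 * \<bar>y\<bar>) / \<theta>1"
      using assms by (intro divide_right_mono) auto
    with abs_bessel_J_left_le[OF assms(1) that, of 1 y] show ?thesis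
      by (simp add: u_def)
  qed
  moreover have "continuous_on UNIV u"
    unfolding u_def by (rule cont)
  ultimately show ?thesis
    by (meson order_refl zero_le_one)
qed

end
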